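(* Let $m\in\mathbb{N}_+$ and $\vartheta=1/\sqrt{m}$. For any $y>0$, $$\lim_{N\to\infty}\gamma_\vartheta\left(x\in\Omega:\ L_N(x)<\frac{Ny}{\log(1+\vartheta^2)}\right)=\exp\left(-\frac1y\right).$$
   Context: $\mathbb{N}_+=\{1,2,3,\ldots\}$. Fix $m\in\mathbb{N}_+$ and let $\vartheta>0$ satisfy $\vartheta^2=1/m$. Define $T_\vartheta:[0,\vartheta]\to[0,\vartheta]$ by $T_\vartheta(0)=0$ and $T_\vartheta(x)=\frac1x-\vartheta\left\lfloor\frac1{x\vartheta}\right\rfloor$ for $x\in(0,\vartheta]$. The digits of the $\vartheta$-expansion of $x\in[0,\vartheta]$ are $b_1(x)=\left\lfloor\frac1{x\vartheta}\right\rfloor$ if $x\ne0$, $b_1(0)=\infty$, and $b_n(x)=b_1(T_\vartheta^{n-1}(x))$ for $n\ge2$. $\Omega=(0,\vartheta)\setminus\mathbb{Q}$. For $N\in\mathbb{N}_+$, $L_N(x)=\max_{1\le n\le N}b_n(x)$. $\gamma_\vartheta$ is the ($T_\vartheta$-invariant) Borel probability measure on $[0,\vartheta]$ given by $\mathrm{d}\gamma_\vartheta=\frac1{\log(1+\vartheta^2)}\frac{\vartheta\,\mathrm{d}x}{1+\vartheta x}$. *)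

theory Defs
  imports "HOL-Probability.Probability"
begin

(* \<theta> is the parameter written \<vartheta> in the literature (\<vartheta> is not a letter symbol). *)

definition T_theta :: "real \<Rightarrow> real \<Rightarrow> real" where
  "T_theta \<theta> x = (if x = 0 then 0 else 1 / x - \<theta> * of_int \<lfloor>1 / (x * \<theta>)\<rfloor>)"

(* For x in (0, \<theta>] with \<theta>^2 = 1/m one has 1 / (x * \<theta>) \<ge> m, so nat does not truncate.
   Digits live in enat because b_1(0) = \<infinity>; for irrational \<theta> this value also occurs
   along orbits of (countably many) irrational points. *)
definition first_digit :: "real \<Rightarrow> real \<Rightarrow> enat" where
  "first_digit \<theta> x = (if x = 0 then \<infinity> else enat (nat \<lfloor>1 / (x * \<theta>)\<rfloor>))"

(* Indices start at 1; the value at n = 0 is never used. *)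
definition digit :: "real \<Rightarrow> nat \<Rightarrow> real \<Rightarrow> enat" where
  "digit \<theta> n x = first_digit \<theta> ((T_theta \<theta> ^^ (n - 1)) x)"

definition max_digit :: "real \<Rightarrow> nat \<Rightarrow> real \<Rightarrow> enat" where
  "max_digit \<theta> N x = Max ((\<lambda>n. digit \<theta> n x) ` {1..N})"

definition Omega :: "real \<Rightarrow> real set" where
  "Omega \<theta> = {0<..<\<theta>} - \<rat>"

definition gamma_theta :: "real \<Rightarrow> real measure" where
  "gamma_theta \<theta> = density (restrict_space lborel {0..\<theta>})
     (\<lambda>x. ennreal (1 / ln (1 + \<theta>\<^sup>2) * (\<theta> / (1 + \<theta> * x))))"

end

theory Submission
  imports Defs
begin

text \<open>
  Write \<open>u\<^sub>i x = 1 / (x + \<theta> * i)\<close>, \<open>i \<ge> m\<close>, for the inverse branches of the map. Since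
  \<open>\<theta> * m = 1 / \<theta>\<close>, every branch is full: \<open>u\<^sub>i\<close> carries \<open>[0, \<theta>)\<close> onto the set of points
  with first digit \<open>i\<close>. The transfer operator of the map with respect to the invariant density \<open>\<rho>\<close>
  is \<open>U f = (\<Sum>i\<ge>m. P\<^sub>i * f \<circ> u\<^sub>i)\<close> with probability weights \<open>P\<^sub>i\<close>. Keeping only the digits
  \<open>i < K\<close> gives the operator \<open>U\<^sub>K\<close> (\<open>transfer K\<close>), and changing variables branch by branch shows
  that the mass of the points whose first \<open>n\<close> digits are below \<open>K\<close> is the integral of
  \<open>F\<^sub>n = U\<^sub>K\<^sup>n 1\<close> against \<open>\<rho>\<close> (\<open>transfer_duality\<close>, \<open>survivors_integral\<close>). Only finitely
  many branches occur.

  The point is that \<open>F\<^sub>n\<close> is nearly constant, uniformly in \<open>n\<close>. Summation by parts turns the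
  variation of the weights into increments of \<open>f\<close> between neighbouring branches, and yields
  \<open>Lip (U\<^sub>K f) \<le> 7/8 * Lip f + 1 / (\<theta> * K)\<close> for \<open>0 \<le> f \<le> 1\<close> (\<open>transfer_lipschitz\<close>): the
  first term is the contraction of the full operator, and the second one is the price for discarding
  the digits from \<open>K\<close> on. As \<open>F\<^sub>0 = 1\<close>, all \<open>F\<^sub>n\<close> have Lipschitz constant at most
  \<open>8 / (\<theta> * K)\<close>, hence oscillation at most \<open>8 / K\<close>.

  Let \<open>a\<^sub>n\<close> be the integral of \<open>F\<^sub>n\<close> and \<open>p = ln (1 + 1/K) / ln (1 + \<theta>\<^sup>2)\<close> the mass of
  the points whose first digit is at least \<open>K\<close>, which form the interval \<open>[0, 1 / (\<theta> * K)]\<close>.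
  Duality gives that \<open>a\<^sub>n - a\<^sub>n\<^sub>+\<^sub>1\<close> is the integral of \<open>F\<^sub>n\<close> over this interval, that is
  \<open>p * a\<^sub>n\<close> up to an error \<open>p * 8 / K\<close>. These errors add up to at most \<open>8 / K\<close>, so that
  \<open>\<bar>a\<^sub>n - (1 - p)\<^sup>n\<bar> \<le> 8 / K\<close> for all \<open>n\<close> (\<open>survivors_geometric\<close>). For the
  threshold of the theorem \<open>K\<close> is \<open>N * y / ln (1 + \<theta>\<^sup>2)\<close> rounded up; then \<open>N * p\<close> tends to \<open>1 / y\<close> and \<open>(1 - p)\<^sup>N\<close> to \<open>exp (- (1 / y))\<close>.
\<close>

section \<open>Sums, integrability and an exponential limit\<close>

lemma sum_by_parts_diff:
  fixes a g :: "nat \<Rightarrow> real"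
  assumes "m < K"
  shows "(\<Sum>i\<in>{m..<K}. (a i - a (Suc i)) * g i) =
         a m * g m - a K * g (K - 1) + (\<Sum>i\<in>{Suc m..<K}. a i * (g i - g (i - 1)))"
proof -
  have "Suc m \<le> K" using assms by simp
  then show ?thesis
    by (induction rule: dec_induct) (simp_all add: algebra_simps)
qed

text \<open>
  The comparison \<open>i\<^sup>3 \<ge> (i - 1) * i * (i + 1)\<close> makes the sum telescope.
\<close>

lemma sum_inverse_cubes_le:
  fixes m K :: nat
  assumes "1 \<le> m"
  shows "(\<Sum>i\<in>{Suc m..<K}. 1 / real i ^ 3) \<le> 1 / (2 * real m * (real m + 1))"
proof (cases "Suc m \<le> K")
  case True
  define t where "t i = 1 / (2 * (real i - 1) * real i)" for i :: nat
  have "(\<Sum>i\<in>{Suc m..<K}. 1 / real i ^ 3) \<le> (\<Sum>i\<in>{Suc m..<K}. t i - t (Suc i))"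
  proof (rule sum_mono)
    fix i assume "i \<in> {Suc m..<K}"
    then have i: "real i > 1" using assms by auto
    have "t i - t (Suc i) = 1 / ((real i - 1) * real i * (real i + 1))"
      using i unfolding t_def by (simp add: divide_simps) (simp add: algebra_simps)
    also have "\<dots> \<ge> 1 / real i ^ 3"
    proof (rule divide_left_mono)
      have "(real i - 1) * real i * (real i + 1) = real i ^ 3 - real i"
        by (simp add: algebra_simps power3_eq_cube)
      then show "(real i - 1) * real i * (real i + 1) \<le> real i ^ 3" using i by simp
    qed (use i in auto)
    finally show "1 / real i ^ 3 \<le> t i - t (Suc i)" .
  qed
  also have "\<dots> = t (Suc m) - t K"
    using True by (induction rule: dec_induct) auto
  also have "\<dots> \<le> t (Suc m)" using True assms by (simp add: t_def)
  also have "\<dots> = 1 / (2 * real m * (real m + 1))" by (simp add: t_def algebra_simps)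
  finally show ?thesis .
qed simp

lemma absolutely_integrable_bounded_borel:
  fixes f :: "real \<Rightarrow> real"
  assumes "f \<in> borel_measurable borel" "\<And>x. x \<in> {a..b} \<Longrightarrow> \<bar>f x\<bar> \<le> C"
  shows "f absolutely_integrable_on {a..b}"
proof (rule measurable_bounded_by_integrable_imp_absolutely_integrable)
  show "f \<in> borel_measurable (lebesgue_on {a..b})"
    by (intro measurable_restrict_space1 measurable_completion) (use assms(1) in simp)
  show "(\<lambda>_. C) integrable_on {a..b}" by (rule integrable_const_ivl)
qed (use assms in auto)

text \<open>
  The usual limit has \<open>p n = c / n\<close>; here only the product \<open>n * p n\<close> is controlled, which
  suffices because \<open>ln (1 - x) / x\<close> tends to \<open>- 1\<close> at \<open>0\<close>.
\<close>

lemma power_one_minus_tendsto_exp: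
  fixes p :: "nat \<Rightarrow> real"
  assumes "(\<lambda>n. real n * p n) \<longlonglongrightarrow> c" "p \<longlonglongrightarrow> 0" "eventually (\<lambda>n. p n \<noteq> 0) sequentially"
  shows "(\<lambda>n. (1 - p n) ^ n) \<longlonglongrightarrow> exp (- c)"
proof -
  have "((\<lambda>x::real. ln (1 - x) / x) \<longlongrightarrow> - 1) (at 0)"
    by real_asymp
  moreover have "filterlim p (at 0) sequentially"
    using assms(2,3) by (simp add: filterlim_at)
  ultimately have "(\<lambda>n. ln (1 - p n) / p n) \<longlonglongrightarrow> - 1"
    by (rule filterlim_compose)
  then have "(\<lambda>n. real n * p n * (ln (1 - p n) / p n)) \<longlonglongrightarrow> c * - 1"
    by (intro tendsto_mult assms(1))
  then have "(\<lambda>n. exp (real n * p n * (ln (1 - p n) / p n))) \<longlonglongrightarrow> exp (- c)"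
    by (intro tendsto_exp) simp
  moreover have "eventually (\<lambda>n. p n < 1) sequentially"
    using assms(2) by (rule order_tendstoD) simp
  with assms(3) have "eventually (\<lambda>n. exp (real n * p n * (ln (1 - p n) / p n)) = (1 - p n) ^ n) sequentially"
  proof eventually_elim
    case (elim n)
    have "exp (real n * p n * (ln (1 - p n) / p n)) = exp (ln (1 - p n)) ^ n"
      using elim by (simp add: exp_of_nat_mult)
    then show ?case using elim by simp
  qed
  ultimately show ?thesis by (rule Lim_transform_eventually)
qed

section \<open>Inverse branches and transition weights\<close>

locale theta_expansion =
  fixes m :: nat and \<theta> :: real
  assumes m_pos: "1 \<le> m" and \<theta>_pos: "0 < \<theta>" and m_\<theta>: "real m * \<theta>\<^sup>2 = 1"
begin

definition branch :: "nat \<Rightarrow> real \<Rightarrow> real" where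
  "branch i x = 1 / (x + \<theta> * real i)"

text \<open>
  Conditional probability of a digit at least \<open>i\<close>: the sum over \<open>j \<ge> i\<close> of the weights
  \<open>\<rho> (u\<^sub>j x) * (u\<^sub>j x)\<^sup>2 / \<rho> x\<close> of the transfer operator in closed form. Taking it as the
  primitive notion, with the weights as its differences, is what summation by parts needs; that the
  weights are the right ones is \<open>branch_density\<close>.
\<close>

definition tail :: "nat \<Rightarrow> real \<Rightarrow> real" where
  "tail i x = (1 + \<theta> * x) / (\<theta> * (x + \<theta> * real i))"

definition weight :: "nat \<Rightarrow> real \<Rightarrow> real" where
  "weight i x = tail i x - tail (Suc i) x"

definition transfer :: "nat \<Rightarrow> (real \<Rightarrow> real) \<Rightarrow> real \<Rightarrow> real" where
  "transfer K f x = (\<Sum>i\<in>{m..<K}. weight i x * f (branch i x))"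

lemma \<theta>_sq: "\<theta>\<^sup>2 = 1 / real m"
  using m_\<theta> m_pos by (simp add: field_simps)

lemma \<theta>_m: "\<theta> * real m = 1 / \<theta>"
  using m_\<theta> \<theta>_pos by (simp add: field_simps power2_eq_square)

lemma denominator_pos: "0 \<le> x \<Longrightarrow> m \<le> i \<Longrightarrow> 0 < x + \<theta> * real i"
  using \<theta>_pos m_pos by (intro add_nonneg_pos) auto

lemma branch_le: "0 \<le> x \<Longrightarrow> m \<le> i \<Longrightarrow> branch i x \<le> 1 / (\<theta> * real i)"
  unfolding branch_def using \<theta>_pos m_pos denominator_pos[of 0 i]
  by (intro divide_left_mono mult_pos_pos denominator_pos) auto

lemma branch_nonneg: "0 \<le> x \<Longrightarrow> m \<le> i \<Longrightarrow> 0 \<le> branch i x"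
  unfolding branch_def using denominator_pos[of x i] by auto

lemma branch_in: assumes "0 \<le> x" "m \<le> i" shows "branch i x \<in> {0..\<theta>}"
proof -
  have "branch i x \<le> 1 / (\<theta> * real m)"
    using branch_le[OF assms] assms \<theta>_pos m_pos
    by (smt (verit) divide_left_mono mult_left_mono mult_pos_pos of_nat_0_less_iff of_nat_mono zero_less_one)
  then show ?thesis using branch_nonneg[OF assms] \<theta>_m by simp
qed

lemma branch_diff:
  assumes "0 \<le> x" "0 \<le> y" "m \<le> i"
  shows "\<bar>branch i x - branch i y\<bar> = branch i x * branch i y * \<bar>x - y\<bar>"
proof -
  have "branch i x - branch i y = branch i x * branch i y * (y - x)"
    unfolding branch_def using denominator_pos[of x i] denominator_pos[of y i] assms
    by (simp add: field_simps)
  then show ?thesis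
    using branch_nonneg[of x i] branch_nonneg[of y i] assms by (simp add: abs_mult abs_minus_commute)
qed

lemma tail_first: "0 \<le> x \<Longrightarrow> tail m x = 1"
proof -
  assume "0 \<le> x"
  have "\<theta> * (x + \<theta> * real m) = 1 + \<theta> * x"
    using m_\<theta> by (simp add: algebra_simps power2_eq_square)
  moreover have "1 + \<theta> * x > 0" using \<open>0 \<le> x\<close> \<theta>_pos by (intro add_pos_nonneg) auto
  ultimately show ?thesis by (simp add: tail_def)
qed

lemma tail_nonneg: "0 \<le> x \<Longrightarrow> m \<le> i \<Longrightarrow> 0 \<le> tail i x"
  unfolding tail_def using denominator_pos[of x i] \<theta>_pos by auto

lemma weight_eq:
  assumes "0 \<le> x" "m \<le> i"
  shows "weight i x = (1 + \<theta> * x) * branch i x * branch (Suc i) x"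
proof -
  have "x + \<theta> * real i \<noteq> 0" "x + \<theta> * real (Suc i) \<noteq> 0"
    using denominator_pos[of x i] denominator_pos[of x "Suc i"] assms by auto
  moreover have "tail i x - tail (Suc i) x =
     (1 + \<theta> * x) / \<theta> * (1 / (x + \<theta> * real i) - 1 / (x + \<theta> * real (Suc i)))"
    unfolding tail_def by (simp add: right_diff_distrib)
  moreover have "x + \<theta> * real (Suc i) - (x + \<theta> * real i) = \<theta>" by (simp add: algebra_simps)
  ultimately show ?thesis
    unfolding weight_def branch_def using \<theta>_pos by (simp add: diff_frac_eq del: of_nat_Suc)
qed

lemma weight_nonneg: "0 \<le> x \<Longrightarrow> m \<le> i \<Longrightarrow> 0 \<le> weight i x"
  using \<theta>_pos by (simp add: weight_eq branch_nonneg)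

text \<open>
  For \<open>m = 1\<close> the branch \<open>u\<^sub>m\<close> has slope \<open>- 1\<close> at \<open>0\<close> and does not contract; it must
  therefore not carry too much of the weight.
\<close>

lemma weight_first_le: assumes "0 \<le> x" shows "weight m x \<le> 1 / 2"
proof -
  have "tail (Suc m) x \<ge> 1 / 2"
  proof -
    have e: "\<theta> * (x + \<theta> * real (Suc m)) = 1 + \<theta> * x + \<theta>\<^sup>2"
      using m_\<theta> by (simp add: algebra_simps power2_eq_square)
    have "\<theta>\<^sup>2 \<le> 1" using m_pos by (simp add: \<theta>_sq)
    moreover have "0 \<le> \<theta> * x" "0 \<le> \<theta>\<^sup>2" using assms \<theta>_pos by auto
    ultimately have "0 < 1 + \<theta> * x + \<theta>\<^sup>2" "1 / 2 * (1 + \<theta> * x + \<theta>\<^sup>2) \<le> 1 + \<theta> * x"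
      by argo+
    then show ?thesis unfolding tail_def e by (simp only: pos_le_divide_eq)
  qed
  then show ?thesis using tail_first[OF assms] by (simp add: weight_def)
qed

lemma sum_weight:
  assumes "0 \<le> x" "m \<le> K"
  shows "(\<Sum>i\<in>{m..<K}. weight i x) = 1 - tail K x"
  using assms(2) by (induction rule: dec_induct) (simp_all add: tail_first assms(1) weight_def)

text \<open>
  The numerator vanishes for \<open>i = m\<close>, where \<open>tail\<close> is constantly \<open>1\<close>; the bound decays like
  \<open>1 / i\<close>.
\<close>

lemma tail_lipschitz:
  assumes "0 \<le> x" "0 \<le> y" "m \<le> i"
  shows "\<bar>tail i x - tail i y\<bar> \<le> (real i - real m) / (\<theta> * real i ^ 2) * \<bar>x - y\<bar>"
proof -
  have d: "x + \<theta> * real i > 0" "y + \<theta> * real i > 0"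
    using assms by (auto intro: denominator_pos)
  have "tail i x - tail i y =
     ((1 + \<theta> * x) * (\<theta> * (y + \<theta> * real i)) - (1 + \<theta> * y) * (\<theta> * (x + \<theta> * real i)))
       / ((\<theta> * (x + \<theta> * real i)) * (\<theta> * (y + \<theta> * real i)))"
    unfolding tail_def using d \<theta>_pos by (subst diff_frac_eq) auto
  also have "\<dots> = (\<theta> * (\<theta>\<^sup>2 * real i - 1) * (x - y))
       / ((\<theta> * (x + \<theta> * real i)) * (\<theta> * (y + \<theta> * real i)))"
    by (simp add: algebra_simps power2_eq_square)
  also have "\<dots> = (\<theta>\<^sup>2 * real i - 1) / \<theta> * (x - y) * (branch i x * branch i y)"
    using d \<theta>_pos by (simp add: branch_def)
  finally have e: "tail i x - tail i y = (\<theta>\<^sup>2 * real i - 1) / \<theta> * (x - y) * (branch i x * branch i y)" .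
  have ge: "\<theta>\<^sup>2 * real i - 1 \<ge> 0"
    using assms(3) m_pos by (simp add: \<theta>_sq)
  have "branch i x * branch i y \<le> 1 / (\<theta> * real i) * (1 / (\<theta> * real i))"
    using assms \<theta>_pos by (intro mult_mono branch_le branch_nonneg) auto
  then have "\<bar>tail i x - tail i y\<bar> \<le> (\<theta>\<^sup>2 * real i - 1) / \<theta> * \<bar>x - y\<bar> * (1 / (\<theta> * real i) * (1 / (\<theta> * real i)))"
  proof -
    assume b: "branch i x * branch i y \<le> 1 / (\<theta> * real i) * (1 / (\<theta> * real i))"
    have "\<bar>tail i x - tail i y\<bar> = (\<theta>\<^sup>2 * real i - 1) / \<theta> * \<bar>x - y\<bar> * (branch i x * branch i y)"
      unfolding e using ge \<theta>_pos assms branch_nonneg[of x i] branch_nonneg[of y i]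
      by (simp add: abs_mult)
    then show ?thesis using b ge \<theta>_pos by (simp only:) (intro mult_left_mono, auto)
  qed
  also have "\<dots> = (real i - real m) / (\<theta> * real i ^ 2) * \<bar>x - y\<bar>"
  proof -
    have "(\<theta>\<^sup>2 * real i - 1) / \<theta> * (1 / (\<theta> * real i) * (1 / (\<theta> * real i)))
       = (real i - 1 / \<theta>\<^sup>2) / (\<theta> * real i ^ 2)"
      using \<theta>_pos assms m_pos by (simp add: divide_simps power2_eq_square)
    moreover have "1 / \<theta>\<^sup>2 = real m" by (simp add: \<theta>_sq)
    ultimately have "(\<theta>\<^sup>2 * real i - 1) / \<theta> * (1 / (\<theta> * real i) * (1 / (\<theta> * real i)))
       = (real i - real m) / (\<theta> * real i ^ 2)"
      by (simp only:)
    moreover have "a * d * b = c * d" if "a * b = c" for a b c d :: real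
      using that by (auto simp: mult_ac)
    ultimately show ?thesis by blast
  qed
  finally show ?thesis .
qed

section \<open>Lipschitz contraction of the truncated transfer operator\<close>

text \<open>
  The product \<open>u\<^sub>i x * u\<^sub>i y\<close> is the contraction factor of the branch \<open>u\<^sub>i\<close>, see
  \<open>branch_diff\<close>. It is at most \<open>1\<close> on the first branch, whose weight is at most \<open>1/2\<close>, and at
  most \<open>m / (m + 1)\<^sup>2 \<le> 1/4\<close> on all others; the average is \<open>1/2 * 1 + 1/2 * 1/4 = 5/8\<close>
  in the worst case.
\<close>

lemma weighted_contraction:
  assumes "0 \<le> x" "0 \<le> y" "m < K"
  shows "(\<Sum>i\<in>{m..<K}. weight i y * (branch i x * branch i y)) \<le> 5 / 8"
proof -
  \<comment> \<open>The value at \<open>x = y = 0\<close> of the contraction factor of the second branch.\<close>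
  define w where "w = 1 / (\<theta> * real (Suc m)) * (1 / (\<theta> * real (Suc m)))"
  have bound: "branch i x * branch i y \<le> 1 / (\<theta> * real j) * (1 / (\<theta> * real j))"
    if "m \<le> j" "j \<le> i" for i j
  proof -
    have "1 / (\<theta> * real i) \<le> 1 / (\<theta> * real j)"
      using that \<theta>_pos m_pos by (intro divide_left_mono mult_pos_pos) auto
    then show ?thesis
      using assms that \<theta>_pos branch_le[of x i] branch_le[of y i]
      by (intro mult_mono branch_nonneg) auto
  qed
  have w0: "branch m x * branch m y \<le> 1"
  proof -
    have "branch m x * branch m y \<le> \<theta> * \<theta>"
      using branch_in[of x m] branch_in[of y m] assms by (intro mult_mono) auto
    also have "\<dots> \<le> 1" using \<theta>_sq m_pos by (simp add: power2_eq_square)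
    finally show ?thesis .
  qed
  have "w = real m / (real m + 1)\<^sup>2"
  proof -
    have "w = 1 / (\<theta>\<^sup>2 * (real m + 1)\<^sup>2)"
      unfolding w_def by (simp add: power2_eq_square algebra_simps)
    then show ?thesis using m_pos by (simp add: \<theta>_sq)
  qed
  also have "\<dots> \<le> 1 / 4"
  proof -
    have "(real m - 1)\<^sup>2 \<ge> 0" by simp
    then have "4 * real m \<le> (real m + 1)\<^sup>2" by (simp add: power2_eq_square algebra_simps)
    then show ?thesis by (simp add: divide_simps)
  qed
  finally have w4: "w \<le> 1 / 4" .
  have "(\<Sum>i\<in>{m..<K}. weight i y * (branch i x * branch i y))
      = weight m y * (branch m x * branch m y)
        + (\<Sum>i\<in>{Suc m..<K}. weight i y * (branch i x * branch i y))"
    using assms(3) by (subst sum.atLeast_Suc_lessThan) auto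
  also have "\<dots> \<le> weight m y * 1 + (\<Sum>i\<in>{Suc m..<K}. weight i y * (1 / 4))"
  proof (intro add_mono sum_mono mult_left_mono w0 weight_nonneg)
    fix i assume "i \<in> {Suc m..<K}"
    then have "branch i x * branch i y \<le> w" unfolding w_def by (intro bound) auto
    then show "branch i x * branch i y \<le> 1 / 4" using w4 by simp
  qed (use assms in auto)
  also have "\<dots> = 3 / 4 * weight m y + 1 / 4 * (\<Sum>i\<in>{m..<K}. weight i y)"
    using assms(3) by (simp add: sum.atLeast_Suc_lessThan sum_divide_distrib [symmetric] field_simps)
  also have "\<dots> \<le> 3 / 4 * (1 / 2) + 1 / 4 * 1"
    using weight_first_le[of y] sum_weight[of y K] tail_nonneg[of y K] assms by (intro add_mono mult_left_mono) auto
  finally show ?thesis by simp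
qed

lemma transfer_bounds:
  assumes "m < K" "\<And>x. x \<in> {0..\<theta>} \<Longrightarrow> f x \<in> {0..1}" "x \<in> {0..\<theta>}"
  shows "transfer K f x \<in> {0..1}"
proof -
  have f: "0 \<le> f (branch i x)" "f (branch i x) \<le> 1" if "m \<le> i" for i
    using assms(2)[OF branch_in[OF _ that, of x]] assms(3) by auto
  have "transfer K f x \<ge> 0"
    unfolding transfer_def using assms(3) f
    by (intro sum_nonneg mult_nonneg_nonneg weight_nonneg) auto
  moreover have "transfer K f x \<le> (\<Sum>i\<in>{m..<K}. weight i x * 1)"
    unfolding transfer_def using assms(3) f by (intro sum_mono mult_left_mono weight_nonneg) auto
  moreover have "\<dots> \<le> 1"
    using sum_weight[of x K] tail_nonneg[of x K] assms by simp
  ultimately show ?thesis by simp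
qed

text \<open>
  A difference of two values of \<open>U\<^sub>K f\<close> has three parts. Moving the arguments of \<open>f\<close> costs
  \<open>5/8 * L\<close> by \<open>weighted_contraction\<close>. Moving the weights is summed by parts: the differences of
  \<open>tail\<close> meet increments of \<open>f\<close> between consecutive branches, so that this costs another
  \<open>1/4 * L\<close> by \<open>sum_inverse_cubes_le\<close>, instead of a constant that does not involve \<open>L\<close>. The
  boundary term at \<open>K\<close> is where the truncation shows; it is bounded through \<open>f \<le> 1\<close> alone and is
  of size \<open>1 / K\<close>.
\<close>

lemma transfer_lipschitz:
  assumes "m < K"
    and f01: "\<And>x. x \<in> {0..\<theta>} \<Longrightarrow> f x \<in> {0..1}"
    and lip: "\<And>x y. x \<in> {0..\<theta>} \<Longrightarrow> y \<in> {0..\<theta>} \<Longrightarrow> \<bar>f x - f y\<bar> \<le> L * \<bar>x - y\<bar>"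
    and x: "x \<in> {0..\<theta>}" and y: "y \<in> {0..\<theta>}"
  shows "\<bar>transfer K f x - transfer K f y\<bar> \<le> (7 / 8 * L + 1 / (\<theta> * real K)) * \<bar>x - y\<bar>"
proof -
  have pos: "0 \<le> x" "0 \<le> y" using x y by auto
  have "0 \<le> L * \<bar>0 - \<theta>\<bar>" using lip[of 0 \<theta>] \<theta>_pos by auto
  then have L: "0 \<le> L" using \<theta>_pos by (simp add: zero_le_mult_iff)
  define g where "g i = f (branch i x)" for i
  define D where "D i = tail i x - tail i y" for i
  have "transfer K f x - transfer K f y
      = (\<Sum>i\<in>{m..<K}. (D i - D (Suc i)) * g i)
        + (\<Sum>i\<in>{m..<K}. weight i y * (f (branch i x) - f (branch i y)))"
    unfolding transfer_def g_def D_def weight_def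
    by (simp add: sum.distrib [symmetric] sum_subtractf [symmetric] algebra_simps)
  also have "(\<Sum>i\<in>{m..<K}. (D i - D (Suc i)) * g i)
      = - D K * g (K - 1) + (\<Sum>i\<in>{Suc m..<K}. D i * (g i - g (i - 1)))"
    unfolding sum_by_parts_diff[OF assms(1)] using tail_first[of x] tail_first[of y] pos
    by (simp add: D_def algebra_simps)
  finally have split: "transfer K f x - transfer K f y
      = - D K * g (K - 1) + (\<Sum>i\<in>{Suc m..<K}. D i * (g i - g (i - 1)))
        + (\<Sum>i\<in>{m..<K}. weight i y * (f (branch i x) - f (branch i y)))" .
  have "\<bar>- D K * g (K - 1)\<bar> \<le> 1 / (\<theta> * real K) * \<bar>x - y\<bar>"
  proof -
    have "\<bar>D K\<bar> \<le> (real K - real m) / (\<theta> * real K ^ 2) * \<bar>x - y\<bar>"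
      unfolding D_def using assms(1) pos by (intro tail_lipschitz) auto
    also have "\<dots> \<le> real K / (\<theta> * real K ^ 2) * \<bar>x - y\<bar>"
      using \<theta>_pos by (intro mult_right_mono divide_right_mono) auto
    also have "\<dots> = 1 / (\<theta> * real K) * \<bar>x - y\<bar>" by (simp add: power2_eq_square)
    finally have "\<bar>D K\<bar> \<le> 1 / (\<theta> * real K) * \<bar>x - y\<bar>" .
    moreover have "\<bar>g (K - 1)\<bar> \<le> 1"
      using f01[OF branch_in[of x "K - 1"]] pos assms(1) unfolding g_def by auto
    ultimately have "\<bar>D K\<bar> * \<bar>g (K - 1)\<bar> \<le> 1 / (\<theta> * real K) * \<bar>x - y\<bar> * 1"
      using \<theta>_pos by (intro mult_mono) auto
    then show ?thesis by (simp add: abs_mult)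
  qed
  moreover have "\<bar>\<Sum>i\<in>{Suc m..<K}. D i * (g i - g (i - 1))\<bar> \<le> 1 / 4 * L * \<bar>x - y\<bar>"
  proof -
    have "\<bar>\<Sum>i\<in>{Suc m..<K}. D i * (g i - g (i - 1))\<bar>
        \<le> (\<Sum>i\<in>{Suc m..<K}. real m * L * \<bar>x - y\<bar> * (1 / real i ^ 3))"
    proof (rule order_trans[OF sum_abs sum_mono])
      fix i assume "i \<in> {Suc m..<K}"
      then have i: "m \<le> i" "m \<le> i - 1" "1 < real i" and i1: "real (i - 1) = real i - 1"
        using m_pos by auto
      have "\<bar>D i\<bar> \<le> (real i - real m) / (\<theta> * real i ^ 2) * \<bar>x - y\<bar>"
        unfolding D_def using i pos by (intro tail_lipschitz) auto
      also have "\<dots> \<le> (real i - 1) / (\<theta> * real i ^ 2) * \<bar>x - y\<bar>"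
        using \<theta>_pos m_pos by (intro mult_right_mono divide_right_mono) auto
      finally have D: "\<bar>D i\<bar> \<le> (real i - 1) / (\<theta> * real i ^ 2) * \<bar>x - y\<bar>" .
      have b: "branch (i - 1) x - branch i x = \<theta> * (branch (i - 1) x * branch i x)"
        unfolding branch_def i1 using denominator_pos[of x i] denominator_pos[of x "i - 1"] pos i
        by (simp add: divide_simps i1) (simp add: algebra_simps)
      have "\<bar>g i - g (i - 1)\<bar> \<le> L * \<bar>branch i x - branch (i - 1) x\<bar>"
        unfolding g_def using i pos by (intro lip branch_in) auto
      also have "\<dots> = L * (\<theta> * (branch (i - 1) x * branch i x))"
        using b branch_nonneg[of x i] branch_nonneg[of x "i - 1"] pos i \<theta>_pos
        by (subst abs_minus_commute) (simp add: abs_mult)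
      also have "\<dots> \<le> L * (\<theta> * (1 / (\<theta> * real (i - 1)) * (1 / (\<theta> * real i))))"
        using L \<theta>_pos pos i by (intro mult_left_mono mult_mono branch_le branch_nonneg) auto
      finally have "\<bar>g i - g (i - 1)\<bar> \<le> L * (\<theta> * (1 / (\<theta> * (real i - 1)) * (1 / (\<theta> * real i))))"
        by (simp only: i1)
      with D have "\<bar>D i\<bar> * \<bar>g i - g (i - 1)\<bar>
          \<le> ((real i - 1) / (\<theta> * real i ^ 2) * \<bar>x - y\<bar>)
            * (L * (\<theta> * (1 / (\<theta> * (real i - 1)) * (1 / (\<theta> * real i)))))"
        using i \<theta>_pos by (intro mult_mono) auto
      also have "\<dots> = 1 / \<theta>\<^sup>2 * L * \<bar>x - y\<bar> * (1 / real i ^ 3)"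
        using i \<theta>_pos by (simp add: divide_simps power2_eq_square power3_eq_cube)
      also have "1 / \<theta>\<^sup>2 = real m" by (simp add: \<theta>_sq)
      finally show "\<bar>D i * (g i - g (i - 1))\<bar> \<le> real m * L * \<bar>x - y\<bar> * (1 / real i ^ 3)"
        by (simp add: abs_mult)
    qed
    also have "\<dots> = real m * L * \<bar>x - y\<bar> * (\<Sum>i\<in>{Suc m..<K}. 1 / real i ^ 3)"
      by (simp add: sum_distrib_left)
    also have "\<dots> \<le> real m * L * \<bar>x - y\<bar> * (1 / (2 * real m * (real m + 1)))"
      using L by (intro mult_left_mono sum_inverse_cubes_le m_pos) auto
    also have "\<dots> = L * \<bar>x - y\<bar> * (1 / (2 * (real m + 1)))" using m_pos by simp
    also have "\<dots> \<le> L * \<bar>x - y\<bar> * (1 / 4)"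
      using L m_pos by (intro mult_left_mono divide_left_mono) auto
    finally show ?thesis by simp
  qed
  moreover have "\<bar>\<Sum>i\<in>{m..<K}. weight i y * (f (branch i x) - f (branch i y))\<bar> \<le> 5 / 8 * L * \<bar>x - y\<bar>"
  proof -
    have "\<bar>\<Sum>i\<in>{m..<K}. weight i y * (f (branch i x) - f (branch i y))\<bar>
        \<le> (\<Sum>i\<in>{m..<K}. L * \<bar>x - y\<bar> * (weight i y * (branch i x * branch i y)))"
    proof (rule order_trans[OF sum_abs sum_mono])
      fix i assume "i \<in> {m..<K}"
      then have "m \<le> i" by simp
      then have "\<bar>f (branch i x) - f (branch i y)\<bar> \<le> L * (branch i x * branch i y * \<bar>x - y\<bar>)"
        using lip[OF branch_in branch_in, of x i y i] branch_diff[of x y i] pos by simp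
      then have "weight i y * \<bar>f (branch i x) - f (branch i y)\<bar>
          \<le> weight i y * (L * (branch i x * branch i y * \<bar>x - y\<bar>))"
        using weight_nonneg[of y i] pos \<open>m \<le> i\<close> by (intro mult_left_mono) auto
      then show "\<bar>weight i y * (f (branch i x) - f (branch i y))\<bar>
          \<le> L * \<bar>x - y\<bar> * (weight i y * (branch i x * branch i y))"
        using weight_nonneg[of y i] pos \<open>m \<le> i\<close> by (simp add: abs_mult mult_ac)
    qed
    also have "\<dots> = L * \<bar>x - y\<bar> * (\<Sum>i\<in>{m..<K}. weight i y * (branch i x * branch i y))"
      by (simp add: sum_distrib_left)
    also have "\<dots> \<le> L * \<bar>x - y\<bar> * (5 / 8)"
      using L pos assms(1) by (intro mult_left_mono weighted_contraction) auto
    finally show ?thesis by simp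
  qed
  ultimately have "\<bar>transfer K f x - transfer K f y\<bar>
      \<le> 1 / (\<theta> * real K) * \<bar>x - y\<bar> + 1 / 4 * L * \<bar>x - y\<bar> + 5 / 8 * L * \<bar>x - y\<bar>"
    unfolding split by linarith
  also have "\<dots> = (7 / 8 * L + 1 / (\<theta> * real K)) * \<bar>x - y\<bar>" by (simp add: algebra_simps)
  finally show ?thesis .
qed

text \<open>
  The constant \<open>8 / (\<theta> * K)\<close> is the fixed point of \<open>L \<mapsto> 7/8 * L + 1 / (\<theta> * K)\<close>.
\<close>

lemma transfer_iterate:
  assumes "m < K"
  shows "(\<forall>x\<in>{0..\<theta>}. (transfer K ^^ n) (\<lambda>_. 1) x \<in> {0..1}) \<and>
    (\<forall>x\<in>{0..\<theta>}. \<forall>y\<in>{0..\<theta>}. \<bar>(transfer K ^^ n) (\<lambda>_. 1) x - (transfer K ^^ n) (\<lambda>_. 1) y\<bar>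
        \<le> 8 / (\<theta> * real K) * \<bar>x - y\<bar>)"
proof (induction n)
  case 0
  then show ?case using \<theta>_pos by auto
next
  case (Suc n)
  let ?f = "(transfer K ^^ n) (\<lambda>_. 1)"
  have fixpoint: "7 / 8 * (8 / (\<theta> * real K)) + 1 / (\<theta> * real K) = 8 / (\<theta> * real K)"
    using \<theta>_pos assms by (simp add: field_simps)
  have "\<bar>transfer K ?f x - transfer K ?f y\<bar> \<le> 8 / (\<theta> * real K) * \<bar>x - y\<bar>"
    if "x \<in> {0..\<theta>}" "y \<in> {0..\<theta>}" for x y
    using transfer_lipschitz[of K ?f "8 / (\<theta> * real K)" x y] Suc assms that
    unfolding fixpoint by blast
  moreover have "transfer K ?f x \<in> {0..1}" if "x \<in> {0..\<theta>}" for x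
    using transfer_bounds[of K ?f x] Suc assms that by blast
  ultimately show ?case by simp
qed

section \<open>The invariant density and the survival probability\<close>

definition \<rho> :: "real \<Rightarrow> real" where
  "\<rho> x = 1 / ln (1 + \<theta>\<^sup>2) * (\<theta> / (1 + \<theta> * x))"

text \<open>
  Points whose first \<open>n\<close> digits are below \<open>K \<ge> 1\<close>: a point of \<open>[0, \<theta>]\<close> has first digit below
  \<open>K\<close> iff it exceeds \<open>u\<^sub>K 0 = 1 / (\<theta> * K)\<close>. In this form an orbit that reaches \<open>0\<close>, where
  the digit is infinite, is excluded without a case distinction.
\<close>

definition survivors :: "nat \<Rightarrow> nat \<Rightarrow> real set" where
  "survivors K n = {x \<in> {0..\<theta>}. \<forall>j<n. branch K 0 < (T_theta \<theta> ^^ j) x}"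

lemma branch_0: "branch i 0 = 1 / (\<theta> * real i)"
  by (simp add: branch_def)

lemma branch_first_0: "branch m 0 = \<theta>"
  using \<theta>_m by (simp add: branch_def)

lemma branch_\<theta>: "branch i \<theta> = branch (Suc i) 0"
  by (simp add: branch_def algebra_simps)

lemma ln_pos: "0 < ln (1 + \<theta>\<^sup>2)"
  using \<theta>_pos by (intro ln_gt_zero) auto

lemma \<rho>_measurable [measurable]: "\<rho> \<in> borel_measurable borel"
  unfolding \<rho>_def by measurable

lemma branch_measurable [measurable]: "branch i \<in> borel_measurable borel"
  unfolding branch_def by measurable

lemma weight_measurable [measurable]: "weight i \<in> borel_measurable borel"
  unfolding weight_def tail_def by measurable

lemma transfer_measurable [measurable]:
  assumes [measurable]: "f \<in> borel_measurable borel"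
  shows "transfer K f \<in> borel_measurable borel"
  unfolding transfer_def by measurable

lemma transfer_iterate_measurable [measurable]:
  "(transfer K ^^ n) (\<lambda>_. 1) \<in> borel_measurable borel"
  by (induction n) simp_all

lemma T_measurable [measurable]: "T_theta \<theta> \<in> borel_measurable borel"
  unfolding T_theta_def by measurable

lemma T_iterate_measurable [measurable]: "T_theta \<theta> ^^ n \<in> borel_measurable borel"
proof (induction n)
  case (Suc n)
  then show ?case by (simp add: measurable_comp[OF _ T_measurable])
qed (simp add: id_def)

lemma survivors_measurable [measurable]: "survivors K n \<in> sets borel"
  unfolding survivors_def by measurable

lemma \<rho>_nonneg: "0 \<le> x \<Longrightarrow> 0 \<le> \<rho> x"
  unfolding \<rho>_def using ln_pos \<theta>_pos
  by (intro mult_nonneg_nonneg divide_nonneg_nonneg add_nonneg_nonneg) auto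

lemma \<rho>_le: assumes "0 \<le> x" shows "\<rho> x \<le> \<theta> / ln (1 + \<theta>\<^sup>2)"
proof -
  have "0 \<le> \<theta> * x" using assms \<theta>_pos by simp
  then have "\<theta> / (1 + \<theta> * x) \<le> \<theta> / 1"
    using \<theta>_pos by (intro divide_left_mono) auto
  then have "\<rho> x \<le> 1 / ln (1 + \<theta>\<^sup>2) * \<theta>"
    unfolding \<rho>_def using ln_pos by (intro mult_left_mono) auto
  then show ?thesis by simp
qed

lemma \<rho>_integral:
  assumes "0 \<le> a"
  shows "(\<rho> has_integral ln (1 + \<theta> * a) / ln (1 + \<theta>\<^sup>2)) {0..a}"
proof -
  have "(\<rho> has_integral ln (1 + \<theta> * a) / ln (1 + \<theta>\<^sup>2) - ln (1 + \<theta> * 0) / ln (1 + \<theta>\<^sup>2)) {0..a}"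
  proof (rule fundamental_theorem_of_calculus[OF assms])
    fix x assume "x \<in> {0..a}"
    then have "0 < 1 + \<theta> * x" using \<theta>_pos by (intro add_pos_nonneg) auto
    then show "((\<lambda>x. ln (1 + \<theta> * x) / ln (1 + \<theta>\<^sup>2)) has_vector_derivative \<rho> x) (at x within {0..a})"
      unfolding \<rho>_def has_real_derivative_iff_has_vector_derivative [symmetric]
      using ln_pos by (auto intro!: derivative_eq_intros)
  qed
  then show ?thesis by simp
qed

lemma integrable_density:
  assumes [measurable]: "f \<in> borel_measurable borel" and "0 \<le> a"
    and "\<And>x. x \<in> {a..b} \<Longrightarrow> \<bar>f x\<bar> \<le> C"
  shows "(\<lambda>x. f x * \<rho> x) absolutely_integrable_on {a..b}"
proof (rule absolutely_integrable_bounded_borel)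
  fix x assume x: "x \<in> {a..b}"
  have "\<bar>f x * \<rho> x\<bar> = \<bar>f x\<bar> * \<rho> x" using \<rho>_nonneg[of x] x assms(2) by (simp add: abs_mult)
  also have "\<dots> \<le> C * (\<theta> / ln (1 + \<theta>\<^sup>2))"
    using assms(3)[OF x] assms(2) x \<rho>_nonneg[of x] \<rho>_le[of x] by (intro mult_mono) auto
  finally show "\<bar>f x * \<rho> x\<bar> \<le> C * (\<theta> / ln (1 + \<theta>\<^sup>2))" .
qed simp

lemma T_in: assumes "x \<in> {0..\<theta>}" shows "T_theta \<theta> x \<in> {0..\<theta>}"
proof (cases "x = 0")
  case False
  then have x: "0 < x" using assms by simp
  have "T_theta \<theta> x = \<theta> * frac (1 / (x * \<theta>))"
    using x \<theta>_pos by (simp add: T_theta_def frac_def algebra_simps)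
  moreover have "0 \<le> frac (1 / (x * \<theta>))" "frac (1 / (x * \<theta>)) \<le> 1"
    by (auto simp: frac_ge_0 less_imp_le[OF frac_lt_1])
  ultimately show ?thesis using \<theta>_pos by simp
qed (use \<theta>_pos in \<open>simp add: T_theta_def\<close>)

lemma T_iterate_in: "x \<in> {0..\<theta>} \<Longrightarrow> (T_theta \<theta> ^^ n) x \<in> {0..\<theta>}"
  by (induction n) (simp_all add: T_in del: atLeastAtMost_iff)

text \<open>
  The endpoint \<open>x = \<theta>\<close> has to be left out: its image under \<open>u\<^sub>i\<close> belongs to the next branch
  and is mapped to \<open>0\<close>.
\<close>

lemma T_branch:
  assumes "0 \<le> x" "x < \<theta>" "m \<le> i"
  shows "T_theta \<theta> (branch i x) = x"
proof -
  have d: "x + \<theta> * real i > 0" using assms by (intro denominator_pos) auto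
  have "1 / (branch i x * \<theta>) = x / \<theta> + real i"
    using d \<theta>_pos by (simp add: branch_def field_simps)
  moreover have "\<lfloor>x / \<theta> + real i\<rfloor> = int i"
    using assms \<theta>_pos by (subst floor_eq_iff) auto
  ultimately show ?thesis using d by (simp add: T_theta_def branch_def)
qed

lemma branch_density:
  assumes "0 \<le> x" "m \<le> i"
  shows "(branch i x)\<^sup>2 * \<rho> (branch i x) = weight i x * \<rho> x"
proof -
  have d: "x + \<theta> * real i > 0" "x + \<theta> * real (Suc i) > 0" "1 + \<theta> * x > 0"
    using assms \<theta>_pos denominator_pos[of x "Suc i"] by (auto intro: denominator_pos add_pos_nonneg)
  have "1 + \<theta> * branch i x = (x + \<theta> * real (Suc i)) * branch i x"
    using d(1) by (simp add: branch_def field_simps)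
  then have "(branch i x)\<^sup>2 * (\<theta> / (1 + \<theta> * branch i x)) = \<theta> * (branch i x * branch (Suc i) x)"
    using d(1,2) by (simp add: branch_def power2_eq_square)
  also have "\<dots> = weight i x * (\<theta> / (1 + \<theta> * x))"
    using d(3) weight_eq[OF assms] by simp
  finally show ?thesis unfolding \<rho>_def by (metis mult.left_commute)
qed

text \<open>
  Change of variables along one branch. Consecutive images share an endpoint because
  \<open>u\<^sub>i \<theta> = u\<^sub>i\<^sub>+\<^sub>1 0\<close>, so that they tile \<open>[u\<^sub>K 0, \<theta>]\<close>.
\<close>

lemma branch_substitution:
  assumes "m \<le> i" "\<phi> absolutely_integrable_on {branch (Suc i) 0..branch i 0}"
  shows "(\<lambda>x. (branch i x)\<^sup>2 * \<phi> (branch i x)) absolutely_integrable_on {0..\<theta>}"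
    and "integral {branch (Suc i) 0..branch i 0} \<phi> =
         integral {0..\<theta>} (\<lambda>x. (branch i x)\<^sup>2 * \<phi> (branch i x))"
proof -
  have img: "branch i ` {0..\<theta>} = {branch (Suc i) 0..branch i 0}"
  proof (intro equalityI subsetI)
    fix z assume "z \<in> branch i ` {0..\<theta>}"
    then obtain x where x: "x \<in> {0..\<theta>}" "z = branch i x" by auto
    have "branch i \<theta> \<le> branch i x" "branch i x \<le> branch i 0"
      unfolding branch_def using x assms(1) denominator_pos[of x i] denominator_pos[of 0 i] denominator_pos[of \<theta> i]
      by (auto intro!: divide_left_mono mult_pos_pos)
    then show "z \<in> {branch (Suc i) 0..branch i 0}" using x by (simp add: branch_\<theta>)
  next
    fix z assume z: "z \<in> {branch (Suc i) 0..branch i 0}"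
    have "0 < branch (Suc i) 0" using \<theta>_pos by (simp add: branch_0)
    then have z0: "0 < z" using z by auto
    have i: "0 < real i" using assms(1) m_pos by simp
    have "1 / (\<theta> * real (Suc i)) \<le> z" "z \<le> 1 / (\<theta> * real i)"
      using z by (auto simp: branch_0 simp del: of_nat_Suc)
    then have "1 \<le> z * (\<theta> * real (Suc i))" "z * (\<theta> * real i) \<le> 1"
      using \<theta>_pos i by (simp_all add: pos_divide_le_eq pos_le_divide_eq del: of_nat_Suc)
    then have "\<theta> * real i \<le> 1 / z" "1 / z \<le> \<theta> * real (Suc i)"
      using z0 by (simp_all add: pos_divide_le_eq pos_le_divide_eq mult.commute del: of_nat_Suc)
    then have "1 / z - \<theta> * real i \<in> {0..\<theta>}" by (simp add: algebra_simps)
    moreover have "z = branch i (1 / z - \<theta> * real i)" by (simp add: branch_def)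
    ultimately show "z \<in> branch i ` {0..\<theta>}" by blast
  qed
  have "(\<lambda>x. \<bar>- (branch i x)\<^sup>2\<bar> * \<phi> (branch i x)) absolutely_integrable_on {0..\<theta>} \<and>
     integral {0..\<theta>} (\<lambda>x. \<bar>- (branch i x)\<^sup>2\<bar> * \<phi> (branch i x)) = integral (branch i ` {0..\<theta>}) \<phi>"
  proof (rule has_absolute_integral_change_of_variables_1'[where g = "branch i" and f = \<phi> and S = "{0..\<theta>}", THEN iffD2])
    show "inj_on (branch i) {0..\<theta>}" by (auto simp: inj_on_def branch_def)
    fix x assume "x \<in> {0..\<theta>}"
    then have "x + \<theta> * real i \<noteq> 0" using denominator_pos[of x i] assms(1) by auto
    then show "(branch i has_real_derivative - (branch i x)\<^sup>2) (at x within {0..\<theta>})"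
      unfolding branch_def by (auto intro!: derivative_eq_intros simp: power2_eq_square)
  qed (use assms(2) img in auto)
  then show "(\<lambda>x. (branch i x)\<^sup>2 * \<phi> (branch i x)) absolutely_integrable_on {0..\<theta>}"
    and "integral {branch (Suc i) 0..branch i 0} \<phi> =
         integral {0..\<theta>} (\<lambda>x. (branch i x)\<^sup>2 * \<phi> (branch i x))"
    by (simp_all add: img)
qed

text \<open>
  The defining property of the transfer operator, restricted to first digits below \<open>K\<close>. On the
  piece that belongs to the branch \<open>u\<^sub>i\<close>, substitution replaces \<open>T x\<close> by the new variable and
  \<open>\<rho>\<close> by \<open>weight i * \<rho>\<close>; adding up the pieces gives the claim.
\<close>

lemma transfer_duality:
  assumes [measurable]: "f \<in> borel_measurable borel" "A \<in> sets borel"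
    and f: "\<And>x. x \<in> {0..\<theta>} \<Longrightarrow> f x \<in> {0..1}" and "m \<le> K"
  shows "integral {branch K 0..\<theta>} (\<lambda>x. f x * indicator A (T_theta \<theta> x) * \<rho> x)
       = integral {0..\<theta>} (\<lambda>x. transfer K f x * indicator A x * \<rho> x)"
proof -
  define \<phi> where "\<phi> x = f x * indicator A (T_theta \<theta> x) * \<rho> x" for x
  have pos: "0 \<le> branch i 0" "branch i 0 \<le> \<theta>" if "m \<le> i" for i
    using branch_in[of 0 i] that by auto
  have dec: "branch (Suc i) 0 \<le> branch i 0" if "m \<le> i" for i
    unfolding branch_0 using \<theta>_pos that m_pos by (intro divide_left_mono) auto
  have \<phi>: "\<phi> absolutely_integrable_on {a..b}" if "0 \<le> a" "b \<le> \<theta>" for a b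
    unfolding \<phi>_def
  proof (rule integrable_density[where C = 1])
    fix x assume "x \<in> {a..b}"
    then have "x \<in> {0..\<theta>}" using that by auto
    then show "\<bar>f x * indicator A (T_theta \<theta> x)\<bar> \<le> 1"
      using f[of x] by (auto simp: indicator_def)
  qed (use that in measurable)
  have on_branch: "(branch i x)\<^sup>2 * \<phi> (branch i x) = weight i x * f (branch i x) * indicator A x * \<rho> x"
    if "x \<in> {0..\<theta>} - {\<theta>}" "m \<le> i" for x i
    using branch_density[of x i] T_branch[of x i] that by (simp add: \<phi>_def)
  have int: "integral {branch (Suc i) 0..branch i 0} \<phi> =
        integral {0..\<theta>} (\<lambda>x. weight i x * f (branch i x) * indicator A x * \<rho> x)"
    and able: "(\<lambda>x. weight i x * f (branch i x) * indicator A x * \<rho> x) integrable_on {0..\<theta>}"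
    if i: "m \<le> i" for i
  proof -
    have abs: "\<phi> absolutely_integrable_on {branch (Suc i) 0..branch i 0}"
      using pos[of i] pos[of "Suc i"] i by (intro \<phi>) auto
    have neg: "negligible {\<theta>}" by simp
    show "integral {branch (Suc i) 0..branch i 0} \<phi> =
        integral {0..\<theta>} (\<lambda>x. weight i x * f (branch i x) * indicator A x * \<rho> x)"
      unfolding branch_substitution(2)[OF i abs] using on_branch i
      by (intro integral_spike[OF neg]) auto
    show "(\<lambda>x. weight i x * f (branch i x) * indicator A x * \<rho> x) integrable_on {0..\<theta>}"
      by (rule integrable_spike[OF set_lebesgue_integral_eq_integral(1)[OF branch_substitution(1)[OF i abs]] neg])
        (simp only: on_branch[OF _ i])
  qed
  have "integral {branch K 0..\<theta>} \<phi> = (\<Sum>i\<in>{m..<K}. integral {branch (Suc i) 0..branch i 0} \<phi>)"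
    using \<open>m \<le> K\<close>
  proof (induction rule: dec_induct)
    case base
    then show ?case by (simp add: branch_first_0)
  next
    case (step i)
    have "integral {branch (Suc i) 0..branch i 0} \<phi> + integral {branch i 0..\<theta>} \<phi>
        = integral {branch (Suc i) 0..\<theta>} \<phi>"
      using pos[of i] pos[of "Suc i"] dec[of i] step
      by (intro Henstock_Kurzweil_Integration.integral_combine set_lebesgue_integral_eq_integral(1) \<phi>) auto
    then show ?case using step by simp
  qed
  also have "\<dots> = (\<Sum>i\<in>{m..<K}. integral {0..\<theta>} (\<lambda>x. weight i x * f (branch i x) * indicator A x * \<rho> x))"
    by (intro sum.cong int) auto
  also have "\<dots> = integral {0..\<theta>} (\<lambda>x. \<Sum>i\<in>{m..<K}. weight i x * f (branch i x) * indicator A x * \<rho> x)"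
    using able by (intro integral_sum [symmetric]) auto
  also have "\<dots> = integral {0..\<theta>} (\<lambda>x. transfer K f x * indicator A x * \<rho> x)"
    by (simp only: transfer_def sum_distrib_right)
  finally show ?thesis unfolding \<phi>_def .
qed

lemma survivors_Suc:
  "x \<in> survivors K (Suc n) \<longleftrightarrow> x \<in> {0..\<theta>} \<and> branch K 0 < x \<and> T_theta \<theta> x \<in> survivors K n"
  using T_in[of x] unfolding survivors_def
  by (auto simp: All_less_Suc2 funpow_Suc_right simp del: funpow.simps(2))

text \<open>
  The induction runs from the outside in, removing the first digit, and changes the integrand from
  \<open>f\<close> to \<open>U\<^sub>K f\<close>; this is why a general \<open>f\<close> is needed although only \<open>f = 1\<close> is of interest.
\<close>

lemma survivors_integral:
  assumes "m < K" and "f \<in> borel_measurable borel" and "\<And>x. x \<in> {0..\<theta>} \<Longrightarrow> f x \<in> {0..1}"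
  shows "integral {0..\<theta>} (\<lambda>x. f x * indicator (survivors K n) x * \<rho> x)
       = integral {0..\<theta>} (\<lambda>x. (transfer K ^^ n) f x * \<rho> x)"
  using assms(2,3)
proof (induction n arbitrary: f)
  case 0
  show ?case by (intro integral_cong) (auto simp: survivors_def)
next
  case (Suc n)
  note [measurable] = Suc.prems(1)
  have cut: "0 \<le> branch K 0" "branch K 0 \<le> \<theta>" using branch_in[of 0 K] assms(1) by auto
  let ?g = "\<lambda>x. f x * indicator (survivors K n) (T_theta \<theta> x) * \<rho> x"
  have "integral {0..\<theta>} (\<lambda>x. f x * indicator (survivors K (Suc n)) x * \<rho> x)
      = integral {0..\<theta>} (\<lambda>x. if x \<in> {branch K 0..\<theta>} then ?g x else 0)"
    using cut by (intro integral_spike[of "{branch K 0}"]) (auto simp: indicator_def survivors_Suc)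
  also have "\<dots> = integral {branch K 0..\<theta>} ?g"
    using cut by (subst integral_restrict_Int) (simp add: Int_absorb1)
  also have "\<dots> = integral {0..\<theta>} (\<lambda>x. transfer K f x * indicator (survivors K n) x * \<rho> x)"
    using Suc.prems assms(1) by (intro transfer_duality) auto
  also have "\<dots> = integral {0..\<theta>} (\<lambda>x. (transfer K ^^ n) (transfer K f) x * \<rho> x)"
    by (intro Suc.IH transfer_measurable transfer_bounds[OF assms(1)] Suc.prems) auto
  finally show ?case by (simp add: funpow_Suc_right del: funpow.simps(2))
qed

lemma transfer_iterate_near_mean:
  assumes "m < K" and "x \<in> {0..\<theta>}"
  shows "\<bar>(transfer K ^^ n) (\<lambda>_. 1) x - integral {0..\<theta>} (\<lambda>t. (transfer K ^^ n) (\<lambda>_. 1) t * \<rho> t)\<bar>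
    \<le> 8 / real K"
proof -
  let ?f = "(transfer K ^^ n) (\<lambda>_. 1)"
  have mass: "(\<rho> has_integral 1) {0..\<theta>}"
    using \<rho>_integral[of \<theta>] \<theta>_pos ln_pos by (simp add: power2_eq_square)
  have f_int: "(\<lambda>t. ?f t * \<rho> t) integrable_on {0..\<theta>}"
    using transfer_iterate[OF assms(1), of n]
    by (intro set_lebesgue_integral_eq_integral(1) integrable_density[where C = 1]) auto
  \<comment> \<open>An interval of length \<open>\<theta>\<close> turns the Lipschitz constant into the oscillation \<open>8 / K\<close>.\<close>
  have osc: "\<bar>?f t - ?f x\<bar> \<le> 8 / real K" if "t \<in> {0..\<theta>}" for t
  proof -
    have "\<bar>?f t - ?f x\<bar> \<le> 8 / (\<theta> * real K) * \<bar>t - x\<bar>"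
      using transfer_iterate[OF assms(1), of n] that assms(2) by blast
    also have "\<dots> \<le> 8 / (\<theta> * real K) * \<theta>"
      using that assms(2) \<theta>_pos by (intro mult_left_mono) auto
    also have "\<dots> = 8 / real K" using \<theta>_pos by simp
    finally show ?thesis .
  qed
  have lower: "((\<lambda>t. (?f x - 8 / real K) * \<rho> t) has_integral (?f x - 8 / real K) * 1) {0..\<theta>}"
    and upper: "((\<lambda>t. (?f x + 8 / real K) * \<rho> t) has_integral (?f x + 8 / real K) * 1) {0..\<theta>}"
    by (intro has_integral_mult_right mass)+
  have "(?f x - 8 / real K) * 1 \<le> integral {0..\<theta>} (\<lambda>t. ?f t * \<rho> t)"
    using osc \<rho>_nonneg
    by (intro has_integral_le[OF lower integrable_integral[OF f_int]] mult_right_mono)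
      (auto simp: abs_le_iff algebra_simps)
  moreover have "integral {0..\<theta>} (\<lambda>t. ?f t * \<rho> t) \<le> (?f x + 8 / real K) * 1"
    using osc \<rho>_nonneg
    by (intro has_integral_le[OF integrable_integral[OF f_int] upper] mult_right_mono)
      (auto simp: abs_le_iff algebra_simps)
  ultimately show ?thesis by (simp add: abs_le_iff)
qed

text \<open>
  Survival is almost a sequence of independent trials with failure probability \<open>p\<close>: in one step
  the fraction \<open>p\<close> of the surviving mass is lost, up to an error \<open>p * 8 / K\<close>, since
  \<open>U\<^sub>K\<^sup>n 1\<close>, the density relative to \<open>\<rho>\<close> of the survivors' positions after \<open>n\<close> steps, is
  nearly constant. Each earlier error is multiplied by \<open>1 - p\<close> in every
  later step, so that the total stays below \<open>8 / K\<close> however large \<open>n\<close> is.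
\<close>

lemma survivors_geometric:
  assumes "m < K"
  defines "p \<equiv> ln (1 + 1 / real K) / ln (1 + \<theta>\<^sup>2)"
  shows "\<bar>integral {0..\<theta>} (\<lambda>x. indicator (survivors K n) x * \<rho> x) - (1 - p) ^ n\<bar> \<le> 8 / real K"
proof -
  define F where "F n = (transfer K ^^ n) (\<lambda>_. 1)" for n
  define a where "a n = integral {0..\<theta>} (\<lambda>x. F n x * \<rho> x)" for n
  define b where "b = branch K 0"
  have b: "0 \<le> b" "b \<le> \<theta>" using branch_in[of 0 K] assms(1) by (auto simp: b_def)
  have K: "0 < real K" using assms(1) by simp
  have F01: "F n x \<in> {0..1}" if "x \<in> {0..\<theta>}" for n x
    using transfer_iterate[OF assms(1), of n] that by (simp add: F_def)
  have F_meas: "F n \<in> borel_measurable borel" for n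
    by (simp add: F_def)
  have F_int: "(\<lambda>x. F n x * \<rho> x) integrable_on {u..v}" if "0 \<le> u" "v \<le> \<theta>" for u v n
  proof (intro set_lebesgue_integral_eq_integral(1) integrable_density[where C = 1] F_meas that)
    fix x assume "x \<in> {u..v}"
    then have "x \<in> {0..\<theta>}" using that by auto
    from F01[OF this, of n] show "\<bar>F n x\<bar> \<le> 1" by auto
  qed
  have mass: "(\<rho> has_integral p) {0..b}"
    using \<rho>_integral[OF b(1)] \<theta>_pos by (simp add: p_def b_def branch_0)
  have "ln (1 + 1 / real K) \<le> ln (1 + \<theta>\<^sup>2)"
    using assms(1) m_pos by (intro ln_mono) (auto simp: \<theta>_sq divide_left_mono intro!: add_pos_nonneg)
  then have p: "0 \<le> p" "p \<le> 1"
    using K ln_pos unfolding p_def by auto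
  have step: "\<bar>a (Suc n) - (1 - p) * a n\<bar> \<le> 8 / real K * p" for n
  proof -
    have "a (Suc n) = integral {b..\<theta>} (\<lambda>x. F n x * \<rho> x)"
      using transfer_duality[OF F_meas[of n], of UNIV K] F01 assms(1)
      by (simp add: a_def F_def b_def)
    also have "\<dots> = a n - integral {0..b} (\<lambda>x. F n x * \<rho> x)"
      using Henstock_Kurzweil_Integration.integral_combine[OF b F_int[of 0 \<theta> n]]
      by (simp add: a_def)
    finally have rec: "a (Suc n) = a n - integral {0..b} (\<lambda>x. F n x * \<rho> x)" .
    have near: "\<bar>F n x - a n\<bar> \<le> 8 / real K" if "x \<in> {0..b}" for x
      using transfer_iterate_near_mean[OF assms(1), of x n] that b by (simp add: F_def a_def)
    have F_b: "((\<lambda>x. F n x * \<rho> x) has_integral integral {0..b} (\<lambda>x. F n x * \<rho> x)) {0..b}"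
      using b by (intro integrable_integral F_int) auto
    have lower: "((\<lambda>x. (a n - 8 / real K) * \<rho> x) has_integral (a n - 8 / real K) * p) {0..b}"
      and upper: "((\<lambda>x. (a n + 8 / real K) * \<rho> x) has_integral (a n + 8 / real K) * p) {0..b}"
      by (intro has_integral_mult_right mass)+
    have "(a n - 8 / real K) * p \<le> integral {0..b} (\<lambda>x. F n x * \<rho> x)"
      using near \<rho>_nonneg
      by (intro has_integral_le[OF lower F_b] mult_right_mono) (auto simp: abs_le_iff algebra_simps)
    moreover have "integral {0..b} (\<lambda>x. F n x * \<rho> x) \<le> (a n + 8 / real K) * p"
      using near \<rho>_nonneg
      by (intro has_integral_le[OF F_b upper] mult_right_mono) (auto simp: abs_le_iff algebra_simps)
    ultimately show ?thesis unfolding rec by (simp add: abs_le_iff algebra_simps)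
  qed
  have "\<bar>a n - (1 - p) ^ n\<bar> \<le> 8 / real K" for n
  proof (induction n)
    case 0
    have "a 0 = 1"
      using \<rho>_integral[of \<theta>] \<theta>_pos ln_pos
      by (simp add: a_def F_def power2_eq_square integral_unique)
    then show ?case by simp
  next
    case (Suc n)
    have "\<bar>(1 - p) * (a n - (1 - p) ^ n)\<bar> \<le> (1 - p) * (8 / real K)"
      using Suc p by (simp add: abs_mult mult_left_mono del: times_divide_eq_right)
    \<comment> \<open>\<open>a (Suc n) - (1 - p) ^ Suc n\<close>, split into the new error and the damped old one.\<close>
    with step[of n] have "\<bar>(a (Suc n) - (1 - p) * a n) + (1 - p) * (a n - (1 - p) ^ n)\<bar>
        \<le> 8 / real K * p + (1 - p) * (8 / real K)"
      by linarith
    also have "8 / real K * p + (1 - p) * (8 / real K) = 8 / real K"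
      by (simp add: algebra_simps add_divide_distrib [symmetric])
    finally show ?case by (simp add: algebra_simps)
  qed
  moreover have "integral {0..\<theta>} (\<lambda>x. indicator (survivors K n) x * \<rho> x) = a n"
    using survivors_integral[OF assms(1), of "\<lambda>_. 1" n] by (simp add: a_def F_def)
  ultimately show ?thesis by simp
qed

section \<open>Digits as survival\<close>

lemma measure_gamma_theta:
  assumes [measurable]: "A \<in> sets borel" and "A \<subseteq> {0..\<theta>}"
  shows "measure (gamma_theta \<theta>) A = integral {0..\<theta>} (\<lambda>x. indicator A x * \<rho> x)"
proof -
  define h where "h x = indicator {0..\<theta>} x * (indicator A x * \<rho> x)" for x
  have h: "integrable lborel h"
  proof (rule Bochner_Integration.integrable_bound[where f = "\<lambda>x. indicator {0..\<theta>} x * (\<theta> / ln (1 + \<theta>\<^sup>2))"])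
    show "AE x in lborel. norm (h x) \<le> norm (indicator {0..\<theta>} x * (\<theta> / ln (1 + \<theta>\<^sup>2)))"
      using \<rho>_nonneg \<rho>_le ln_pos \<theta>_pos by (intro AE_I2) (auto simp: h_def indicator_def)
    show "integrable lborel (\<lambda>x. indicator {0..\<theta>} x * (\<theta> / ln (1 + \<theta>\<^sup>2)))"
      by (intro integrable_mult_left integrable_real_indicator) (auto simp: emeasure_lborel_Icc_eq)
    show "h \<in> borel_measurable lborel" unfolding h_def by measurable
  qed
  have h0: "0 \<le> h x" for x using \<rho>_nonneg[of x] by (auto simp: h_def indicator_def)
  have meas: "(\<lambda>x. ennreal (\<rho> x)) \<in> borel_measurable (restrict_space lborel {0..\<theta>})"
    by (intro measurable_restrict_space1) measurable
  have A: "A \<in> sets (restrict_space lborel {0..\<theta>})"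
    using assms by (simp add: sets_restrict_space_iff)
  have "gamma_theta \<theta> = density (restrict_space lborel {0..\<theta>}) (\<lambda>x. ennreal (\<rho> x))"
    unfolding gamma_theta_def \<rho>_def by simp
  then have "emeasure (gamma_theta \<theta>) A
      = (\<integral>\<^sup>+ x. ennreal (\<rho> x) * indicator A x \<partial>restrict_space lborel {0..\<theta>})"
    using emeasure_density[OF meas A] by simp
  also have "\<dots> = (\<integral>\<^sup>+ x. ennreal (\<rho> x) * indicator A x * indicator {0..\<theta>} x \<partial>lborel)"
    by (intro nn_integral_restrict_space) simp
  also have "\<dots> = (\<integral>\<^sup>+ x. ennreal (h x) \<partial>lborel)"
    by (intro nn_integral_cong) (auto simp: h_def indicator_def)
  also have "\<dots> = ennreal (integral\<^sup>L lborel h)"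
    by (intro nn_integral_eq_integral h AE_I2 h0)
  finally have "measure (gamma_theta \<theta>) A = integral\<^sup>L lborel h"
    by (simp add: measure_def integral_nonneg_AE h0)
  also have "\<dots> = integral UNIV h" using integral_lborel[OF h] by simp
  also have "h = (\<lambda>x. if x \<in> {0..\<theta>} then indicator A x * \<rho> x else 0)"
    by (auto simp: h_def fun_eq_iff)
  also have "integral UNIV \<dots> = integral {0..\<theta>} (\<lambda>x. indicator A x * \<rho> x)"
    by (rule integral_restrict_UNIV)
  finally show ?thesis .
qed

lemma first_digit_less_iff:
  assumes "z \<in> {0..\<theta>}" "0 < u"
  shows "ereal_of_enat (first_digit \<theta> z) < ereal u \<longleftrightarrow> branch (nat \<lceil>u\<rceil>) 0 < z"
proof (cases "z = 0")
  case True
  then show ?thesis using \<theta>_pos by (simp add: first_digit_def branch_0 not_less)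
next
  case False
  then have z: "0 < z" using assms by simp
  have K: "0 < \<lceil>u\<rceil>" using assms(2) by simp
  have "0 \<le> \<lfloor>1 / (z * \<theta>)\<rfloor>" using z \<theta>_pos by simp
  then have "ereal_of_enat (first_digit \<theta> z) < ereal u \<longleftrightarrow> of_int \<lfloor>1 / (z * \<theta>)\<rfloor> < u"
    using False by (simp add: first_digit_def)
  also have "\<dots> \<longleftrightarrow> 1 / (z * \<theta>) < of_int \<lceil>u\<rceil>"
    by (simp add: less_ceiling_iff [symmetric] floor_less_iff)
  also have "\<dots> \<longleftrightarrow> 1 / (\<theta> * of_int \<lceil>u\<rceil>) < z"
    using z \<theta>_pos K by (simp add: field_simps)
  finally show ?thesis using K by (simp add: branch_0)
qed

lemma max_digit_less_iff:
  assumes "x \<in> {0..\<theta>}" "0 < u" "1 \<le> N"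
  shows "ereal_of_enat (max_digit \<theta> N x) < ereal u \<longleftrightarrow> x \<in> survivors (nat \<lceil>u\<rceil>) N"
proof -
  have less_Max: "ereal_of_enat (Max S) < ereal u \<longleftrightarrow> (\<forall>d\<in>S. ereal_of_enat d < ereal u)"
    if "finite S" "S \<noteq> {}" for S
    using Max_in[OF that] Max_ge[OF that(1)] by (meson ereal_of_enat_le_iff le_less_trans)
  have "ereal_of_enat (max_digit \<theta> N x) < ereal u
      \<longleftrightarrow> (\<forall>n\<in>{1..N}. ereal_of_enat (digit \<theta> n x) < ereal u)"
    unfolding max_digit_def using assms(3) by (subst less_Max) auto
  also have "\<dots> \<longleftrightarrow> (\<forall>n\<in>{1..N}. branch (nat \<lceil>u\<rceil>) 0 < (T_theta \<theta> ^^ (n - 1)) x)"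
    unfolding digit_def using first_digit_less_iff[OF T_iterate_in[OF assms(1)] assms(2)] by simp
  also have "\<dots> \<longleftrightarrow> (\<forall>j<N. branch (nat \<lceil>u\<rceil>) 0 < (T_theta \<theta> ^^ j) x)"
  proof (intro iffI allI impI ballI)
    fix j assume "\<forall>n\<in>{1..N}. branch (nat \<lceil>u\<rceil>) 0 < (T_theta \<theta> ^^ (n - 1)) x" "j < N"
    then show "branch (nat \<lceil>u\<rceil>) 0 < (T_theta \<theta> ^^ j) x" by (auto dest!: bspec[of _ _ "Suc j"])
  qed auto
  finally show ?thesis using assms(1) by (simp add: survivors_def)
qed

text \<open>
  The exceptional set between \<open>\<Omega>\<close> and \<open>[0, \<theta>]\<close> is countable, hence invisible to the integral.
\<close>

lemma measure_max_digit:
  assumes "0 < u" "1 \<le> N"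
  shows "measure (gamma_theta \<theta>) {x \<in> Omega \<theta>. ereal_of_enat (max_digit \<theta> N x) < ereal u}
    = integral {0..\<theta>} (\<lambda>x. indicator (survivors (nat \<lceil>u\<rceil>) N) x * \<rho> x)"
proof -
  define E where "E = survivors (nat \<lceil>u\<rceil>) N"
  have [measurable]: "E \<in> sets borel" unfolding E_def by measurable
  have Q: "countable (\<rat> :: real set)" by (rule countable_rat)
  have Om: "Omega \<theta> \<subseteq> {0..\<theta>}" by (auto simp: Omega_def)
  have [measurable]: "Omega \<theta> \<in> sets borel"
    unfolding Omega_def using sets.countable[OF _ Q, of borel] by auto
  have "{x \<in> Omega \<theta>. ereal_of_enat (max_digit \<theta> N x) < ereal u} = Omega \<theta> \<inter> E"
    using max_digit_less_iff[OF _ assms] Om unfolding E_def by auto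
  then have "measure (gamma_theta \<theta>) {x \<in> Omega \<theta>. ereal_of_enat (max_digit \<theta> N x) < ereal u}
      = integral {0..\<theta>} (\<lambda>x. indicator (Omega \<theta> \<inter> E) x * \<rho> x)"
    using Om by (subst measure_gamma_theta [symmetric]) auto
  also have "\<dots> = integral {0..\<theta>} (\<lambda>x. indicator E x * \<rho> x)"
  proof (rule integral_spike)
    show "negligible (\<rat> \<union> {0, \<theta>})" 
      using Q by (simp add: negligible_iff_null_sets null_sets_completionI countable_imp_null_set_lborel)
  qed (auto simp: Omega_def indicator_def)
  finally show ?thesis by (simp add: E_def)
qed

end

section \<open>The limit law\<close>

theorem theorem4p5:
  fixes m :: nat and \<theta> y :: real
  assumes "m \<ge> 1" and "\<theta> = 1 / sqrt (real m)" and "y > 0"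
  shows "(\<lambda>N. measure (gamma_theta \<theta>)
            {x \<in> Omega \<theta>. ereal_of_enat (max_digit \<theta> N x) < ereal (real N * y / ln (1 + \<theta>\<^sup>2))})
         \<longlonglongrightarrow> exp (- (1 / y))"
proof -
  interpret theta_expansion m \<theta>
    by unfold_locales (use assms in \<open>auto simp: power_divide\<close>)
  define c where "c = y / ln (1 + \<theta>\<^sup>2)"
  have c: "0 < c" using assms(3) ln_pos by (simp add: c_def)
  define K where "K N = nat \<lceil>real N * c\<rceil>" for N
  define p where "p N = ln (1 + 1 / real (K N)) / ln (1 + \<theta>\<^sup>2)" for N
  have K_real: "real (K N) = of_int \<lceil>real N * c\<rceil>" for N
    using c by (simp add: K_def)
  have K_top: "filterlim (\<lambda>N. real (K N)) at_top sequentially"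
  proof (rule filterlim_at_top_mono)
    show "filterlim (\<lambda>N. real N * c) at_top sequentially"
      using c by real_asymp
    show "\<forall>\<^sub>F N in sequentially. real N * c \<le> real (K N)"
      by (simp add: K_real)
  qed
  have ratio: "(\<lambda>N. real N / real (K N)) \<longlonglongrightarrow> 1 / c"
  proof -
    have "(\<lambda>N. real (K N) / real N) \<longlonglongrightarrow> c"
      unfolding K_real using c by real_asymp
    from tendsto_divide[OF tendsto_const[of 1] this] c show ?thesis by simp
  qed
  have "((\<lambda>k::real. k * ln (1 + 1 / k)) \<longlongrightarrow> 1) at_top" by real_asymp
  from filterlim_compose[OF this K_top]
  have log: "(\<lambda>N. real (K N) * ln (1 + 1 / real (K N))) \<longlonglongrightarrow> 1" .
  have "(\<lambda>N. real N / real (K N) * (real (K N) * ln (1 + 1 / real (K N))) / ln (1 + \<theta>\<^sup>2))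
      \<longlonglongrightarrow> 1 / c * 1 / ln (1 + \<theta>\<^sup>2)"
    using ln_pos by (intro tendsto_intros ratio log) simp
  moreover have "1 / c * 1 / ln (1 + \<theta>\<^sup>2) = 1 / y" using ln_pos by (simp add: c_def)
  moreover have "real N / real (K N) * (real (K N) * ln (1 + 1 / real (K N))) / ln (1 + \<theta>\<^sup>2)
      = real N * p N" for N
    by (cases "K N = 0") (simp_all add: p_def)
  ultimately have Np: "(\<lambda>N. real N * p N) \<longlonglongrightarrow> 1 / y" by simp
  have large: "eventually (\<lambda>N. m < K N \<and> 1 \<le> N) sequentially"
    using eventually_conj[OF K_top[THEN filterlim_at_top_dense[THEN iffD1], rule_format, of "real m"]
        eventually_ge_at_top[of 1]] by simp
  have "((\<lambda>k::real. ln (1 + 1 / k)) \<longlongrightarrow> 0) at_top" by real_asymp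
  from filterlim_compose[OF this K_top]
  have p_null: "p \<longlonglongrightarrow> 0"
    unfolding p_def using ln_pos by (auto intro!: tendsto_eq_intros)
  have "eventually (\<lambda>N. p N \<noteq> 0) sequentially"
    using large
  proof eventually_elim
    case (elim N)
    then have "0 < ln (1 + 1 / real (K N))" by (intro ln_gt_zero) auto
    then show ?case using ln_pos by (simp add: p_def)
  qed
  from power_one_minus_tendsto_exp[OF Np p_null this]
  have limit: "(\<lambda>N. (1 - p N) ^ N) \<longlonglongrightarrow> exp (- (1 / y))" .
  let ?M = "\<lambda>N. measure (gamma_theta \<theta>)
            {x \<in> Omega \<theta>. ereal_of_enat (max_digit \<theta> N x) < ereal (real N * y / ln (1 + \<theta>\<^sup>2))}"
  have "eventually (\<lambda>N. norm (?M N - (1 - p N) ^ N) \<le> 8 / real (K N)) sequentially"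
    using large
  proof eventually_elim
    case (elim N)
    have u: "real N * y / ln (1 + \<theta>\<^sup>2) = real N * c" by (simp add: c_def)
    have "?M N = integral {0..\<theta>} (\<lambda>x. indicator (survivors (K N) N) x * \<rho> x)"
      unfolding u K_def using elim c by (intro measure_max_digit) auto
    then show ?case
      using survivors_geometric[of "K N" N] elim by (simp add: p_def)
  qed
  moreover have "(\<lambda>N. 8 / real (K N)) \<longlonglongrightarrow> 0"
    by (intro tendsto_divide_0[OF tendsto_const] filterlim_at_top_imp_at_infinity K_top)
  ultimately have "(\<lambda>N. ?M N - (1 - p N) ^ N) \<longlonglongrightarrow> 0"
    by (rule Lim_null_comparison)
  from tendsto_add[OF this limit] show ?thesis by simp
qed

end
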